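(* Let $A\in\mathbb{R}^{n\times n}$, $C\in\mathbb{R}^{m\times n}$ and let $\alpha>0$. If $(A,C)$ is observable, then the linear system $$\dot P = A^\top P + PA + \alpha\,\mathrm{tr}(P)\,C^\top C$$ is strictly positive on $\mathbb{S}_+^n$.
   Context: $\mathbb{S}_+^n$ is the cone of real symmetric positive semidefinite $n\times n$ matrices, regarded as a cone in the space of real symmetric $n\times n$ matrices; its interior $\mathrm{Int}\,\mathbb{S}_+^n$ is the set of positive definite matrices, and $X\preceq Y$ means $Y-X\in\mathbb{S}_+^n$. The pair $(A,C)$ is observable if the stacked matrix $\mathrm{col}(C,CA,\dots,CA^{n-1})$ has full (column) rank $n$. A map $T$ with $T(\mathbb{S}_+^n)\subseteq\mathbb{S}_+^n$ is strictly order-preserving (also called strongly order-preserving) if $0\preceq X\preceq Y$ and $X\neq Y$ imply $T(Y)-T(X)\in\mathrm{Int}\,\mathbb{S}_+^n$. Write $\phi(t,P_0)$ for the solution at time $t$ of the differential equation with initial value $P_0$ at time $0$. The system is strictly positive on $\mathbb{S}_+^n$ if for every $t>0$ the map $P_0\mapsto\phi(t,P_0)$ maps $\mathbb{S}_+^n$ into itself and is strictly order-preserving. *)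

theory Defs
  imports "HOL-Analysis.Analysis"
begin

section \<open>Positive semidefinite cone\<close>

definition sym_matrices :: "(real^'n^'n) set"
  where "sym_matrices = {X. transpose X = X}"

definition psd_cone :: "(real^'n^'n) set"
  where "psd_cone = {X \<in> sym_matrices. \<forall>v. 0 \<le> v \<bullet> (X *v v)}"

text \<open>
  The interior is taken relative to the symmetric matrices: in the space of all square
  matrices the cone has empty interior as soon as the dimension is at least 2.
\<close>
definition int_psd_cone :: "(real^'n^'n) set"
  where "int_psd_cone = (top_of_set sym_matrices) interior_of psd_cone"

definition loewner_le :: "real^'n^'n \<Rightarrow> real^'n^'n \<Rightarrow> bool"  (infix \<open>\<preceq>\<close> 50)
  where "X \<preceq> Y \<longleftrightarrow> Y - X \<in> psd_cone"

lemma int_psd_cone_eq_posdef: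
  "(int_psd_cone :: (real^'n^'n) set) =
    {X \<in> sym_matrices. \<forall>v. v \<noteq> 0 \<longrightarrow> 0 < v \<bullet> (X *v v)}"
    (is "_ = ?PD")
proof
  show "int_psd_cone \<subseteq> ?PD"
  proof
    fix X :: "real^'n^'n"
    assume X: "X \<in> int_psd_cone"
    have op: "openin (top_of_set sym_matrices) (int_psd_cone :: (real^'n^'n) set)"
      unfolding int_psd_cone_def by (rule openin_interior_of)
    then have sym: "X \<in> sym_matrices"
      using X openin_imp_subset by blast
    obtain e where e: "e > 0"
        "\<And>Y. Y \<in> sym_matrices \<Longrightarrow> dist Y X < e \<Longrightarrow> Y \<in> int_psd_cone"
      using op X unfolding openin_euclidean_subtopology_iff by meson
    define d where "d = e / 2 / (norm (mat 1 :: real^'n^'n) + 1)"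
    have d: "d > 0"
      using e(1) by (simp add: d_def add_nonneg_pos)
    have "d * norm (mat 1 :: real^'n^'n) \<le> d * (norm (mat 1 :: real^'n^'n) + 1)"
      using d by simp
    also have "\<dots> = e / 2"
    proof -
      have "norm (mat 1 :: real^'n^'n) + 1 \<noteq> 0"
        using norm_ge_zero[of "mat 1 :: real^'n^'n"] by linarith
      then show ?thesis
        unfolding d_def by (metis nonzero_eq_divide_eq)
    qed
    finally have le: "d * norm (mat 1 :: real^'n^'n) \<le> e / 2" .
    let ?Y = "X - d *\<^sub>R mat 1"
    have "dist ?Y X < e"
      using d e(1) le by (simp add: dist_norm)
    moreover have "?Y \<in> sym_matrices"
      using sym by (auto simp: sym_matrices_def transpose_def vec_eq_iff mat_def)
    ultimately have "?Y \<in> int_psd_cone"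
      using e(2) by blast
    then have Y: "?Y \<in> psd_cone"
      unfolding int_psd_cone_def by (rule subsetD[OF interior_of_subset])
    have "0 < v \<bullet> (X *v v)" if "v \<noteq> 0" for v
    proof -
      have "0 \<le> v \<bullet> (?Y *v v)"
        using Y by (simp add: psd_cone_def)
      also have "?Y *v v = X *v v - d *\<^sub>R v"
        by (simp add: matrix_vector_mult_diff_rdistrib scaleR_matrix_vector_assoc[symmetric])
      finally have "d * (v \<bullet> v) \<le> v \<bullet> (X *v v)"
        by (simp add: inner_diff_right)
      moreover have "0 < d * (v \<bullet> v)"
        using d that by simp
      ultimately show ?thesis by linarith
    qed
    then show "X \<in> ?PD"
      using sym by simp
  qed
next
  have bound: "norm (Z *v v) \<le> real CARD('n) * real CARD('n) * norm Z * norm v"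
    for Z :: "real^'n^'n" and v
  proof -
    have "\<bar>Z $ i $ j\<bar> \<le> norm Z" for i j
      using component_le_norm_cart[of "Z $ i" j] Finite_Cartesian_Product.norm_nth_le[of Z i]
      by linarith
    then have "onorm ((*v) Z) \<le> real CARD('n) * real CARD('n) * norm Z"
      by (rule onorm_le_matrix_component)
    then show ?thesis
      by (rule order_trans[OF onorm[OF matrix_vector_mul_bounded_linear] mult_right_mono]) simp
  qed
  define K where "K = real CARD('n) * real CARD('n)"
  have K: "K > 0"
    by (simp add: K_def)
  have "openin (top_of_set sym_matrices) ?PD"
    unfolding openin_euclidean_subtopology_iff
  proof (intro conjI ballI)
    fix X :: "real^'n^'n"
    assume X: "X \<in> ?PD"
    let ?S = "sphere (0 :: real^'n) 1"
    have "?S \<noteq> {}"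
      by simp
    moreover have "continuous_on ?S (\<lambda>v. v \<bullet> (X *v v))"
      by (intro continuous_intros linear_continuous_on matrix_vector_mul_bounded_linear)
    ultimately obtain u where u: "u \<in> ?S" "\<And>v. v \<in> ?S \<Longrightarrow> u \<bullet> (X *v u) \<le> v \<bullet> (X *v v)"
      by (metis (no_types, lifting) continuous_attains_inf[OF compact_sphere])
    define c where "c = u \<bullet> (X *v u)"
    have "u \<noteq> 0"
      using u(1) by auto
    then have c: "c > 0"
      using X by (simp add: c_def)
    have low: "c * (v \<bullet> v) \<le> v \<bullet> (X *v v)" for v
    proof (cases "v = 0")
      case False
      define w where "w = (1 / norm v) *\<^sub>R v"
      have "w \<in> ?S"
        using False by (simp add: w_def)
      then have "c \<le> w \<bullet> (X *v w)"
        using u(2) c_def by simp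
      also have "\<dots> = (v \<bullet> (X *v v)) / (v \<bullet> v)"
        by (simp add: w_def matrix_vector_mult_scaleR dot_square_norm power2_eq_square)
      finally show ?thesis
        using False by (simp add: field_simps)
    qed simp
    have "Y \<in> ?PD" if Y: "Y \<in> sym_matrices" "dist Y X < c / K" for Y
    proof -
      have "0 < v \<bullet> (Y *v v)" if v: "v \<noteq> 0" for v
      proof -
        have "\<bar>v \<bullet> ((Y - X) *v v)\<bar> \<le> norm v * norm ((Y - X) *v v)"
          by (rule Cauchy_Schwarz_ineq2)
        also have "\<dots> \<le> norm v * (K * norm (Y - X) * norm v)"
          unfolding K_def by (intro mult_left_mono bound) simp
        also have "\<dots> = K * norm (Y - X) * (v \<bullet> v)"
          by (simp add: dot_square_norm power2_eq_square)
        also have "\<dots> < c * (v \<bullet> v)"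
          using Y(2) K v by (intro mult_strict_right_mono) (auto simp: dist_norm field_simps)
        finally have "\<bar>v \<bullet> ((Y - X) *v v)\<bar> < c * (v \<bullet> v)" .
        moreover have "v \<bullet> (Y *v v) = v \<bullet> (X *v v) + v \<bullet> ((Y - X) *v v)"
          by (simp add: matrix_vector_mult_diff_rdistrib inner_diff_right)
        ultimately show ?thesis
          using low[of v] by linarith
      qed
      then show ?thesis
        using Y(1) by simp
    qed
    then show "\<exists>e>0. \<forall>Y\<in>sym_matrices. dist Y X < e \<longrightarrow> Y \<in> ?PD"
      using c K by (intro exI[of _ "c / K"]) auto
  qed auto
  moreover have "?PD \<subseteq> psd_cone"
  proof
    fix X :: "real^'n^'n"
    assume X: "X \<in> ?PD"
    have "0 \<le> v \<bullet> (X *v v)" for v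
      using X by (cases "v = 0") (auto intro: less_imp_le)
    then show "X \<in> psd_cone"
      using X by (simp add: psd_cone_def)
  qed
  ultimately show "?PD \<subseteq> int_psd_cone"
    unfolding int_psd_cone_def by (intro interior_of_maximal)
qed

section \<open>Observability\<close>

text \<open>
  The power operation that the library provides on \<open>real^'n^'n\<close> is componentwise,
  so powers with respect to the matrix product need their own definition.
\<close>
primrec matrix_power :: "real^'n^'n \<Rightarrow> nat \<Rightarrow> real^'n^'n"
  where
    "matrix_power A 0 = mat 1"
  | "matrix_power A (Suc k) = A ** matrix_power A k"

text \<open>
  The stacked matrix \<open>col (C, C A, \<dots>, C A^(n - 1))\<close> with \<open>n = CARD('n)\<close>. Its rows are indexed by
  pairs \<open>(b, i)\<close>: row \<open>i\<close> of block number \<open>to_nat_on UNIV b\<close>, where \<open>to_nat_on UNIV\<close> is a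
  bijection from the finite type \<open>'n\<close> onto \<open>{..<n}\<close>.
\<close>
definition observability_matrix :: "real^'n^'n \<Rightarrow> real^'n^'m \<Rightarrow> real^'n^('n \<times> 'm)"
  where "observability_matrix A C =
    (\<chi> p. (C ** matrix_power A (to_nat_on (UNIV :: 'n set) (fst p))) $ snd p)"

definition observable :: "real^'n^'n \<Rightarrow> real^'n^'m \<Rightarrow> bool"
  where "observable A C \<longleftrightarrow> rank (observability_matrix A C) = CARD('n)"

section \<open>Flows and strict positivity\<close>

definition is_solution ::
    "('a::real_normed_vector \<Rightarrow> 'a) \<Rightarrow> 'a \<Rightarrow> (real \<Rightarrow> 'a) \<Rightarrow> bool"
  where "is_solution f x0 x \<longleftrightarrow>
    x 0 = x0 \<and> (\<forall>t\<ge>0. (x has_vector_derivative f (x t)) (at t within {0..}))"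

text \<open>
  The value at time \<open>t\<close> of the solution starting at \<open>x0\<close>. It is only specified when solutions
  on \<open>{0..}\<close> exist and have a unique value at time \<open>t\<close>.
\<close>
definition flow :: "('a::real_normed_vector \<Rightarrow> 'a) \<Rightarrow> real \<Rightarrow> 'a \<Rightarrow> 'a"
  where "flow f t x0 = (THE y. \<exists>x. is_solution f x0 x \<and> x t = y)"

definition strictly_order_preserving :: "(real^'n^'n \<Rightarrow> real^'n^'n) \<Rightarrow> bool"
  where "strictly_order_preserving T \<longleftrightarrow>
    (\<forall>X Y. 0 \<preceq> X \<and> X \<preceq> Y \<and> X \<noteq> Y \<longrightarrow> T Y - T X \<in> int_psd_cone)"

definition strictly_positive_system :: "(real^'n^'n \<Rightarrow> real^'n^'n) \<Rightarrow> bool"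
  where "strictly_positive_system f \<longleftrightarrow>
    (\<forall>t>0. flow f t ` psd_cone \<subseteq> psd_cone \<and> strictly_order_preserving (flow f t))"

end

theory Submission
  imports Defs
begin

text \<open>
  The equation is linear, so it suffices that a solution starting at a nonzero positive
  semidefinite matrix is positive definite at every later time. If \<open>w' = - A w\<close>, then
  \<open>w(t) \<bullet> P(t) w(t)\<close> has derivative \<open>\<alpha> tr (P(t)) |C w(t)|\<^sup>2\<close>. Hence these forms are nondecreasing as long
  as the trace is nonnegative, which keeps the trace positive forever. If such a form vanished at
  time \<open>T > 0\<close>, it would vanish on \<open>[0, T]\<close>, so \<open>C w = 0\<close> there; differentiating gives
  \<open>C A^k w = 0\<close> for all \<open>k\<close>, and observability forces \<open>w = 0\<close>.
\<close>

section \<open>Linear differential equations: existence, uniqueness and the flow\<close>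

text \<open>The solution is the exponential series with terms \<open>t ^ k / k!\<close> times
  \<open>L ^ k v\<close>, shifted in time by \<open>t0\<close>. It exists on the whole real line, so
  later arguments can prescribe a value at any time and use two-sided derivatives.\<close>

lemma linear_ode_solution_exists:
  fixes L :: "'a::euclidean_space \<Rightarrow> 'a"
  assumes L: "bounded_linear L"
  shows "\<exists>x. x t0 = v \<and> (\<forall>t. (x has_vector_derivative L (x t)) (at t))"
proof -
  interpret L: bounded_linear L by fact
  obtain K where K: "\<And>x. norm (L x) \<le> norm x * K" "K > 0"
    using L.pos_bounded by blast
  have Lk: "norm ((L ^^ k) v) \<le> norm v * K ^ k" for k
  proof (induction k)
    case (Suc k)
    have "norm ((L ^^ Suc k) v) \<le> norm ((L ^^ k) v) * K" using K(1) by simp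
    also have "\<dots> \<le> (norm v * K ^ k) * K"
      using Suc K(2) by (intro mult_right_mono) auto
    finally show ?case by (simp add: mult_ac)
  qed simp
  define a where "a t k = (t ^ k / fact k) *\<^sub>R (L ^^ k) v" for t :: real and k
  have summ: "summable (a t)" for t
  proof (rule summable_comparison_test')
    show "summable (\<lambda>k. norm v * (inverse (fact k) * (K * \<bar>t\<bar>) ^ k))"
      by (intro summable_mult summable_exp)
    show "norm (a t k) \<le> norm v * (inverse (fact k) * (K * \<bar>t\<bar>) ^ k)" if "k \<ge> 0" for k
    proof -
      have "norm (a t k) = (\<bar>t\<bar> ^ k / fact k) * norm ((L ^^ k) v)"
        by (simp add: a_def power_abs)
      also have "\<dots> \<le> (\<bar>t\<bar> ^ k / fact k) * (norm v * K ^ k)"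
        by (intro mult_left_mono Lk) auto
      finally show ?thesis by (simp add: divide_inverse power_mult_distrib mult_ac)
    qed
  qed
  define S where "S t = (\<Sum>k. a t k)" for t
  have der: "(S has_vector_derivative L (S t)) (at t)" for t
    unfolding has_vector_derivative_def
  \<comment> \<open>Each coordinate of the series is a scalar power series, so termwise
    differentiation applies to it.\<close>
  proof (rule has_derivative_componentwise_within[THEN iffD2], rule ballI)
    fix b :: 'a assume "b \<in> Basis"
    define c where "c k = (L ^^ k) v \<bullet> b / fact k" for k
    have ac: "a t k \<bullet> b = c k * t ^ k" for t k by (simp add: a_def c_def)
    have Sb: "S t \<bullet> b = (\<Sum>k. c k * t ^ k)" for t
      unfolding S_def ac[symmetric]
      by (rule bounded_linear.suminf[OF bounded_linear_inner_left summ])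
    have "summable (\<lambda>k. c k * t ^ k)" for t
      unfolding ac[symmetric] by (rule bounded_linear.summable[OF bounded_linear_inner_left summ])
    from termdiffs_strong_converges_everywhere[OF this]
    have "((\<lambda>t. S t \<bullet> b) has_field_derivative (\<Sum>k. diffs c k * t ^ k)) (at t)"
      unfolding Sb .
    also have "(\<Sum>k. diffs c k * t ^ k) = L (S t) \<bullet> b"
    proof -
      have "L (S t) \<bullet> b = (\<Sum>k. L (a t k) \<bullet> b)"
        unfolding S_def
        by (rule bounded_linear.suminf[OF bounded_linear_compose[OF bounded_linear_inner_left L]
              summ])
      also have "(\<lambda>k. L (a t k) \<bullet> b) = (\<lambda>k. diffs c k * t ^ k)"
      proof
        fix k
        have "diffs c k = (L ^^ Suc k) v \<bullet> b / fact k"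
          by (simp add: diffs_def c_def del: of_nat_Suc)
        then show "L (a t k) \<bullet> b = diffs c k * t ^ k"
          by (simp add: a_def L.scaleR)
      qed
      finally show ?thesis by simp
    qed
    finally show "((\<lambda>t. S t \<bullet> b) has_derivative (\<lambda>x. (x *\<^sub>R L (S t)) \<bullet> b)) (at t)"
      by (simp add: has_field_derivative_def mult_commute_abs)
  qed
  show ?thesis
  proof (intro exI[of _ "\<lambda>t. S (t - t0)"] conjI allI)
    show "S (t0 - t0) = v"
    proof -
      have "S 0 = (\<Sum>k\<in>{0}. a 0 k)"
        unfolding S_def by (rule suminf_finite) (auto simp: a_def)
      then show ?thesis by (simp add: a_def)
    qed
    show "((\<lambda>t. S (t - t0)) has_vector_derivative L (S (t - t0))) (at t)" for t
    proof -
      have "((\<lambda>t. t - t0) has_vector_derivative 1) (at t)"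
        by (auto intro!: derivative_eq_intros)
      from vector_diff_chain_at[OF this der] show ?thesis by (simp add: o_def)
    qed
  qed
qed

text \<open>Gronwall: the squared norm, damped by an exponential, does not increase.\<close>
lemma linear_ode_zero:
  fixes L :: "'a::real_inner \<Rightarrow> 'a"
  assumes L: "bounded_linear L"
    and sol: "is_solution L 0 x" and "t \<ge> 0"
  shows "x t = 0"
proof -
  have "x 0 = 0"
    and x: "\<And>t. t \<ge> 0 \<Longrightarrow> (x has_vector_derivative L (x t)) (at t within {0..})"
    using sol by (auto simp: is_solution_def)
  interpret L: bounded_linear L by fact
  obtain K where K: "\<And>x. norm (L x) \<le> norm x * K"
    using L.pos_bounded by blast
  \<comment> \<open>By Cauchy-Schwarz \<open>x s \<bullet> L (x s)\<close> is at most
    \<open>K * (x s \<bullet> x s)\<close>; the rate \<open>2 * K\<close> is chosen so that the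
    derivative of \<open>g\<close> is nonpositive.\<close>
  define g where "g s = exp (- 2 * K * s) * (x s \<bullet> x s)" for s
  have der: "(g has_real_derivative exp (- 2 * K * s) * (2 * (x s \<bullet> L (x s)) - 2 * K * (x s \<bullet> x s)))
      (at s within {0..})" if "s \<ge> 0" for s
  proof -
    have "((\<lambda>s. x s \<bullet> x s) has_vector_derivative x s \<bullet> L (x s) + L (x s) \<bullet> x s) (at s within {0..})"
      using bounded_bilinear.has_vector_derivative[OF bounded_bilinear_inner x[OF that] x[OF that]] .
    then have "((\<lambda>s. x s \<bullet> x s) has_real_derivative 2 * (x s \<bullet> L (x s))) (at s within {0..})"
      by (simp add: has_real_derivative_iff_has_vector_derivative inner_commute)
    then show ?thesis unfolding g_def
      by (auto intro!: derivative_eq_intros simp: algebra_simps)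
  qed
  have "g t \<le> g 0"
  proof (rule DERIV_nonpos_imp_decreasing_open[OF \<open>t \<ge> 0\<close>])
    show "continuous_on {0..t} g"
      by (rule continuous_on_subset[of "{0..}"])
        (auto simp: continuous_on_eq_continuous_within intro: DERIV_continuous der)
    fix s assume s: "0 < s" "s < t"
    have "x s \<bullet> L (x s) \<le> K * (x s \<bullet> x s)"
      using norm_cauchy_schwarz[of "x s" "L (x s)"] mult_left_mono[OF K[of "x s"], of "norm (x s)"]
      by (simp add: dot_square_norm power2_eq_square mult_ac)
    moreover have "at s within {0..} = at s"
      using s by (intro at_within_interior) (simp add: interior_real_atLeast)
    ultimately show "\<exists>y. (g has_real_derivative y) (at s) \<and> y \<le> 0"
      using der[of s] s
      by (intro exI conjI) (auto simp: mult_nonneg_nonpos)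
  qed
  then have "exp (- 2 * K * t) * (x t \<bullet> x t) \<le> 0"
    by (simp add: g_def \<open>x 0 = 0\<close>)
  then show ?thesis
    by (metis exp_gt_zero inner_eq_zero_iff inner_ge_zero mult_le_0_iff not_le order_antisym)
qed

lemma is_solution_linear_diff:
  assumes L: "bounded_linear L" and x: "is_solution L x0 x" and y: "is_solution L y0 y"
  shows "is_solution L (y0 - x0) (\<lambda>t. y t - x t)"
  unfolding is_solution_def
proof (intro conjI allI impI)
  show "y 0 - x 0 = y0 - x0"
    using x y by (simp add: is_solution_def)
  fix t :: real assume "t \<ge> 0"
  then have "(x has_vector_derivative L (x t)) (at t within {0..})"
    "(y has_vector_derivative L (y t)) (at t within {0..})"
    using x y by (simp_all add: is_solution_def)
  from has_vector_derivative_diff[OF this(2) this(1)]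
  show "((\<lambda>t. y t - x t) has_vector_derivative L (y t - x t)) (at t within {0..})"
    by (simp add: linear_diff[OF bounded_linear.linear[OF L]])
qed

text \<open>The description in \<open>flow\<close> is resolved by uniqueness: the difference of two
  solutions with the same initial value is a solution starting at 0.\<close>

lemma flow_linear_eq:
  fixes L :: "'a::euclidean_space \<Rightarrow> 'a"
  assumes L: "bounded_linear L" and x: "is_solution L x0 x" and "t \<ge> 0"
  shows "flow L t x0 = x t"
  unfolding flow_def
proof (rule the_equality)
  show "\<exists>x'. is_solution L x0 x' \<and> x' t = x t" using x by blast
  fix y assume "\<exists>x. is_solution L x0 x \<and> x t = y"
  then obtain z where z: "is_solution L x0 z" "z t = y" by blast
  have "is_solution L 0 (\<lambda>t. z t - x t)"
    using is_solution_linear_diff[OF L x z(1)] by simp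
  from linear_ode_zero[OF L this \<open>t \<ge> 0\<close>] have "z t - x t = 0" .
  then show "y = x t" using z by simp
qed

section \<open>Positive semidefinite matrices and their trace\<close>

lemma inner_axis_matrix_axis: "axis i 1 \<bullet> (X *v axis j 1) = (X :: real^'n^'n) $ i $ j"
  by (simp add: matrix_vector_mult_basis column_def inner_axis')

lemma psd_cone_quadratic_form_nonneg: "X \<in> psd_cone \<Longrightarrow> 0 \<le> v \<bullet> (X *v v)"
  by (simp add: psd_cone_def)

text \<open>The diagonal entries are nonnegative, so a nonpositive trace makes them all vanish.
  Testing the form on \<open>axis i 1 + c *\<^sub>R axis j 1\<close> then leaves only a term linear
  in \<open>c\<close>, and both signs of \<open>c\<close> force the entry at \<open>i\<close>,
  \<open>j\<close> to be 0.\<close>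

lemma psd_trace_pos:
  assumes X: "X \<in> psd_cone" and "X \<noteq> 0"
  shows "trace X > 0"
proof (rule ccontr)
  have diag: "X $ i $ i \<ge> 0" for i
    using psd_cone_quadratic_form_nonneg[OF X, of "axis i 1"] by (simp add: inner_axis_matrix_axis)
  assume "\<not> trace X > 0"
  then have "trace X = 0"
    using diag by (simp add: trace_def sum_nonneg antisym)
  then have diag0: "X $ i $ i = 0" for i
    using diag by (simp add: trace_def sum_nonneg_eq_0_iff)
  have "X $ i $ j = 0" for i j
  proof -
    have "X $ j $ i = X $ i $ j"
      using X by (auto simp: psd_cone_def sym_matrices_def transpose_def vec_eq_iff)
    then have "(axis i 1 + c *\<^sub>R axis j 1) \<bullet> (X *v (axis i 1 + c *\<^sub>R axis j 1)) = 2 * c * X $ i $ j" for c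
      by (simp add: matrix_vector_right_distrib inner_add_left inner_add_right
          matrix_vector_mult_scaleR inner_axis_matrix_axis diag0)
    then have "0 \<le> 2 * c * X $ i $ j" for c
      using psd_cone_quadratic_form_nonneg[OF X, of "axis i 1 + c *\<^sub>R axis j 1"] by simp
    from this[of 1] this[of "-1"] show ?thesis by simp
  qed
  then show False using \<open>X \<noteq> 0\<close> by (simp add: vec_eq_iff)
qed

lemma psd_nonzero_imp_pos_direction:
  assumes X: "X \<in> psd_cone" "X \<noteq> 0"
  obtains u where "u \<bullet> (X *v u) > 0"
proof -
  have "\<not> trace X \<le> 0"
    using psd_trace_pos[OF X] by simp
  then obtain i where "X $ i $ i > 0"
    unfolding trace_def using sum_nonpos[of UNIV "\<lambda>i. X $ i $ i"] by (auto simp: not_le[symmetric])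
  then show thesis
    using that[of "axis i 1"] by (simp add: inner_axis_matrix_axis)
qed

section \<open>Observability: trajectories with zero output\<close>

lemma bounded_bilinear_matrix_vector_mult:
  "bounded_bilinear ((*v) :: real^'n^'m \<Rightarrow> real^'n \<Rightarrow> real^'m)"
  unfolding bilinear_conv_bounded_bilinear[symmetric] bilinear_def
  by (auto intro!: linearI simp: matrix_vector_mult_add_rdistrib matrix_vector_right_distrib
      matrix_vector_mult_scaleR scaleR_matrix_vector_assoc)

text \<open>Every entry of the stacked matrix applied to \<open>x\<close> is an entry of some
  \<open>C A^k x\<close>, and full column rank means injectivity.\<close>

lemma observable_imp_kernel_trivial:
  assumes "observable A C" and "\<And>k. C *v (matrix_power A k *v x) = 0"
  shows "x = 0"
proof -
  have "observability_matrix A C *v x = 0"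
  proof -
    have "(observability_matrix A C *v x) $ p =
        (C *v (matrix_power A (to_nat_on (UNIV :: 'a set) (fst p)) *v x)) $ snd p" for p
      unfolding matrix_vector_mul_assoc
      by (simp add: observability_matrix_def matrix_vector_mult_def)
    then show ?thesis using assms(2) by (simp add: vec_eq_iff)
  qed
  moreover have "inj ((*v) (observability_matrix A C))"
    using assms(1) by (simp add: observable_def full_rank_injective)
  ultimately show ?thesis by (metis injD matrix_vector_mult_0_right)
qed

lemma matrix_power_commute: "matrix_power A k ** A = A ** matrix_power A k"
  by (induction k) (simp_all add: matrix_mul_assoc[symmetric])

lemma output_zero_imp_zero:
  fixes A :: "real^'n^'n" and C :: "real^'n^'m"
  assumes obs: "observable A C"
    and w: "\<And>t. (w has_vector_derivative - (A *v w t)) (at t)"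
    and out: "\<And>s. 0 < s \<Longrightarrow> s < T \<Longrightarrow> C *v w s = 0"
    and s: "0 < s" "s < T"
  shows "w s = 0"
proof (rule observable_imp_kernel_trivial[OF obs])
  show "C *v (matrix_power A k *v w s) = 0" for k
    using s
  \<comment> \<open>The time \<open>s\<close> is generalised because differentiating at
    \<open>s\<close> requires the output to vanish on a neighbourhood of \<open>s\<close>; each
    derivative brings in one more factor \<open>- A\<close>.\<close>
  proof (induction k arbitrary: s)
    case 0
    then show ?case using out by simp
  next
    case (Suc k)
    let ?g = "\<lambda>s. C *v (matrix_power A k *v w s)"
    have "bounded_linear (\<lambda>x. C *v (matrix_power A k *v x))"
      by (intro bounded_linear_compose[OF matrix_vector_mul_bounded_linear]
          matrix_vector_mul_bounded_linear)
    from bounded_linear.has_vector_derivative[OF this w]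
    have "(?g has_vector_derivative C *v (matrix_power A k *v - (A *v w s))) (at s)" .
    moreover have "(?g has_vector_derivative 0) (at s)"
      by (rule has_vector_derivative_transform_within_open[of "\<lambda>_. 0" _ _ "{0<..<T}"])
        (use Suc in auto)
    ultimately have "C *v (matrix_power A k *v - (A *v w s)) = 0"
      by (rule vector_derivative_unique_at)
    then have "C *v (matrix_power A k *v (A *v w s)) = 0"
      by (simp add: linear_neg[OF matrix_vector_mul_linear])
    then show ?case
      by (simp add: matrix_vector_mul_assoc matrix_power_commute)
  qed
qed

section \<open>The Lyapunov operator with trace term and its quadratic forms\<close>

definition trace_lyapunov :: "real^'n^'n \<Rightarrow> real^'n^'m \<Rightarrow> real \<Rightarrow> real^'n^'n \<Rightarrow> real^'n^'n"
  where "trace_lyapunov A C \<alpha> P =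
    transpose A ** P + P ** A + (\<alpha> * trace P) *\<^sub>R (transpose C ** C)"

lemma bounded_linear_trace_lyapunov: "bounded_linear (trace_lyapunov A C \<alpha>)"
proof -
  have "linear (trace_lyapunov A C \<alpha>)"
    by (rule linearI)
      (simp_all add: trace_lyapunov_def vec_eq_iff matrix_matrix_mult_def transpose_def trace_def
        sum.distrib algebra_simps sum_distrib_left)
  then show ?thesis by (simp add: linear_conv_bounded_linear)
qed

lemma transpose_trace_lyapunov:
  "transpose (trace_lyapunov A C \<alpha> P) = trace_lyapunov A C \<alpha> (transpose P)"
proof -
  have "transpose (transpose A ** P + P ** A + c *\<^sub>R (transpose C ** C)) =
      transpose (transpose A ** P) + transpose (P ** A) + c *\<^sub>R transpose (transpose C ** C)" for c
    by (simp add: transpose_def vec_eq_iff)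
  moreover have "trace (transpose P) = trace P"
    by (simp add: trace_def transpose_def)
  ultimately show ?thesis
    by (simp add: trace_lyapunov_def matrix_transpose_mul add_ac)
qed

text \<open>The backward dynamics of \<open>w\<close> contributes \<open>- A\<close> in both
  arguments of the form, which cancels \<open>transpose A ** P + P ** A\<close>; only the trace term
  survives.\<close>

lemma quadratic_form_derivative:
  assumes P: "(P has_vector_derivative trace_lyapunov A C \<alpha> (P s)) (at s)"
    and w: "(w has_vector_derivative - (A *v w s)) (at s)"
  shows "((\<lambda>s. w s \<bullet> (P s *v w s)) has_real_derivative
    \<alpha> * trace (P s) * (norm (C *v w s))\<^sup>2) (at s)"
proof -
  \<comment> \<open>Moves a transposed factor, written as a left product, across the inner
    product.\<close>
  have adj: "y \<bullet> (x v* M) = (M *v y) \<bullet> x" for M :: "real^'k^'l" and x y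
    by (metis dot_lmul_matrix inner_commute)
  note pw = bounded_bilinear.has_vector_derivative[OF bounded_bilinear_matrix_vector_mult P w]
  note q = bounded_bilinear.has_vector_derivative[OF bounded_bilinear_inner w pw]
  have "w s \<bullet> (P s *v - (A *v w s) + trace_lyapunov A C \<alpha> (P s) *v w s)
        + - (A *v w s) \<bullet> (P s *v w s)
      = \<alpha> * trace (P s) * (norm (C *v w s))\<^sup>2"
    by (simp add: trace_lyapunov_def matrix_vector_mult_add_rdistrib
        scaleR_matrix_vector_assoc[symmetric] matrix_vector_mul_assoc[symmetric] inner_add_right adj
        linear_neg[OF matrix_vector_mul_linear] power2_norm_eq_inner)
  with q show ?thesis by (simp add: has_real_derivative_iff_has_vector_derivative)
qed

text \<open>The sign of the trace is required only strictly between \<open>a\<close> and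
  \<open>b\<close>, so \<open>b\<close> may be a time at which that sign is still in
  question.\<close>

lemma quadratic_form_nondecreasing:
  assumes P: "\<And>t. (P has_vector_derivative trace_lyapunov A C \<alpha> (P t)) (at t)"
    and w: "\<And>t. (w has_vector_derivative - (A *v w t)) (at t)"
    and \<alpha>: "\<alpha> > 0"
    and tr: "\<And>t. a < t \<Longrightarrow> t < b \<Longrightarrow> trace (P t) \<ge> 0"
    and "a \<le> b"
  shows "w a \<bullet> (P a *v w a) \<le> w b \<bullet> (P b *v w b)"
proof (rule DERIV_nonneg_imp_increasing_open[OF \<open>a \<le> b\<close>])
  note der = quadratic_form_derivative[OF P w]
  show "\<exists>y. ((\<lambda>t. w t \<bullet> (P t *v w t)) has_real_derivative y) (at s) \<and> y \<ge> 0" if "a < s" "s < b" for s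
    using der[of s] tr[OF that] \<alpha> by (intro exI[of _ "\<alpha> * trace (P s) * (norm (C *v w s))\<^sup>2"]) auto
  show "continuous_on {a..b} (\<lambda>t. w t \<bullet> (P t *v w t))"
    using der by (intro has_real_derivative_imp_continuous_on)
qed

section \<open>Positivity of solutions along backward trajectories\<close>

lemma backward_solution_exists:
  fixes A :: "real^'n^'n"
  shows "\<exists>w. w t0 = v \<and> (\<forall>t. (w has_vector_derivative - (A *v w t)) (at t))"
  by (intro linear_ode_solution_exists bounded_linear_minus matrix_vector_mul_bounded_linear)

text \<open>
  A first time at which the trace vanishes cannot exist: up to that time all the quadratic forms
  are nondecreasing along backward trajectories, so the matrix would still be
  positive semidefinite and nonzero.
\<close>
lemma trace_solution_pos:
  fixes A :: "real^'n^'n" and C :: "real^'n^'m"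
  assumes P: "\<And>t. (P has_vector_derivative trace_lyapunov A C \<alpha> (P t)) (at t)"
    and sym: "\<And>t. t \<ge> 0 \<Longrightarrow> P t \<in> sym_matrices"
    and P0: "P 0 \<in> psd_cone" "P 0 \<noteq> 0"
    and \<alpha>: "\<alpha> > 0" and "t \<ge> 0"
  shows "trace (P t) > 0"
proof (rule ccontr)
  have contP: "continuous_on UNIV P"
    using P by (auto simp: continuous_on_eq_continuous_at intro: has_vector_derivative_continuous)
  have cont: "continuous_on UNIV (\<lambda>s. trace (P s))"
    unfolding trace_def by (intro continuous_intros contP)
  \<comment> \<open>The least element \<open>s\<close> of this compact set is the first time with
    nonpositive trace.\<close>
  define Z where "Z = {0..t} \<inter> {s. trace (P s) \<le> 0}"
  assume "\<not> trace (P t) > 0"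
  then have "Z \<noteq> {}" using \<open>t \<ge> 0\<close> by (auto simp: Z_def)
  moreover have "compact Z"
    unfolding Z_def by (intro compact_Int_closed closed_Collect_le cont continuous_intros) auto
  ultimately obtain s where s: "s \<in> Z" "\<And>r. r \<in> Z \<Longrightarrow> s \<le> r"
    using compact_attains_inf by metis
  have "s \<ge> 0" using s(1) by (simp add: Z_def)
  have tr: "trace (P r) \<ge> 0" if "0 < r" "r < s" for r
  proof (rule ccontr)
    assume "\<not> trace (P r) \<ge> 0"
    then have "r \<in> Z" using s(1) that by (simp add: Z_def)
    then show False using s(2) that by fastforce
  qed
  note mono = quadratic_form_nondecreasing[OF P _ \<alpha> tr \<open>s \<ge> 0\<close>]
  have "v \<bullet> (P s *v v) \<ge> 0" for v
  proof -
    \<comment> \<open>For semidefiniteness the trajectory is prescribed at the final time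
      \<open>s\<close>, since every direction \<open>v\<close> there must be tested.\<close>
    obtain w where w: "w s = v" "\<And>t. (w has_vector_derivative - (A *v w t)) (at t)"
      using backward_solution_exists[of s v A] by blast
    have "0 \<le> w 0 \<bullet> (P 0 *v w 0)" using P0(1) by (simp add: psd_cone_def)
    also have "\<dots> \<le> w s \<bullet> (P s *v w s)" using mono[OF w(2)] .
    finally show ?thesis using w(1) by simp
  qed
  then have "P s \<in> psd_cone"
    using sym[OF \<open>s \<ge> 0\<close>] by (simp add: psd_cone_def)
  moreover have "P s \<noteq> 0"
  proof
    assume "P s = 0"
    obtain u where u: "u \<bullet> (P 0 *v u) > 0"
      using psd_nonzero_imp_pos_direction[OF P0] .
    \<comment> \<open>For nonvanishing it is prescribed at time 0 instead, in a direction where the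
      initial form is positive.\<close>
    obtain w where w: "w 0 = u" "\<And>t. (w has_vector_derivative - (A *v w t)) (at t)"
      using backward_solution_exists[of 0 u A] by blast
    show False
      using mono[OF w(2)] u by (simp add: w(1) \<open>P s = 0\<close>)
  qed
  ultimately have "trace (P s) > 0" by (rule psd_trace_pos)
  then show False using s(1) by (simp add: Z_def)
qed

lemma solution_posdef:
  fixes A :: "real^'n^'n" and C :: "real^'n^'m"
  assumes P: "\<And>t. (P has_vector_derivative trace_lyapunov A C \<alpha> (P t)) (at t)"
    and sym: "\<And>t. t \<ge> 0 \<Longrightarrow> P t \<in> sym_matrices"
    and P0: "P 0 \<in> psd_cone" "P 0 \<noteq> 0"
    and \<alpha>: "\<alpha> > 0" and obs: "observable A C" and T: "T > 0"
  shows "P T \<in> int_psd_cone"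
proof -
  have trace_pos: "trace (P t) > 0" if "t \<ge> 0" for t
    using P sym P0 \<alpha> that by (rule trace_solution_pos)
  have "v \<bullet> (P T *v v) > 0" if "v \<noteq> 0" for v
  proof (rule ccontr)
    assume neg: "\<not> v \<bullet> (P T *v v) > 0"
    obtain w where w: "w T = v" "\<And>t. (w has_vector_derivative - (A *v w t)) (at t)"
      using backward_solution_exists[of T v A] by blast
    define q where "q t = w t \<bullet> (P t *v w t)" for t
    have mono: "q a \<le> q b" if "0 \<le> a" "a \<le> b" for a b
      unfolding q_def
    proof (rule quadratic_form_nondecreasing[OF P w(2) \<alpha> _ \<open>a \<le> b\<close>])
      show "trace (P t) \<ge> 0" if "a < t" for t
        using trace_pos[of t] that \<open>0 \<le> a\<close> by simp
    qed
    have "q 0 \<ge> 0" "q T \<le> 0"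
      using P0(1) neg by (simp_all add: q_def psd_cone_def w(1))
    \<comment> \<open>Monotonicity squeezes \<open>q s\<close> between \<open>q 0 \<ge> 0\<close>
      and \<open>q T \<le> 0\<close>.\<close>
    then have q0: "q s = 0" if "0 \<le> s" "s \<le> T" for s
      using mono[of 0 s] mono[of s T] that by linarith
    have out: "C *v w s = 0" if s: "0 < s" "s < T" for s
    proof -
      have "(q has_real_derivative 0) (at s)"
        by (rule has_field_derivative_transform_within_open[of "\<lambda>_. 0" _ _ "{0<..<T}"])
          (use s q0 in auto)
      moreover have "(q has_real_derivative \<alpha> * trace (P s) * (norm (C *v w s))\<^sup>2) (at s)"
        unfolding q_def by (rule quadratic_form_derivative[OF P w(2)])
      ultimately have "\<alpha> * trace (P s) * (norm (C *v w s))\<^sup>2 = 0"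
        by (rule DERIV_unique[symmetric])
      then show ?thesis using \<alpha> trace_pos[of s] s by simp
    qed
    \<comment> \<open>Observability gives \<open>w s = 0\<close> only for \<open>s\<close> strictly
      between 0 and \<open>T\<close>; continuity from the left carries this to
      \<open>T\<close>.\<close>
    have "w T = 0"
    proof (rule tendsto_unique)
      show "(w \<longlongrightarrow> w T) (at_left T)"
        using has_vector_derivative_continuous[OF has_vector_derivative_at_within[OF w(2)]]
        unfolding continuous_within .
      have "eventually (\<lambda>s. w s = 0) (at_left T)"
        using output_zero_imp_zero[OF obs w(2) out] T by (intro eventually_at_leftI[of 0]) auto
      then show "(w \<longlongrightarrow> 0) (at_left T)"
        by (simp add: tendsto_eventually)
    qed simp
    then show False using \<open>v \<noteq> 0\<close> w(1) by simp
  qed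
  then show ?thesis
    using sym[of T] T by (simp add: int_psd_cone_eq_posdef)
qed

section \<open>Invariance of the symmetric matrices and strict positivity of the flow\<close>

text \<open>The operator commutes with transposition, so the transposed solution solves the same
  problem and uniqueness identifies the two.\<close>

lemma is_solution_trace_lyapunov_sym:
  assumes P: "is_solution (trace_lyapunov A C \<alpha>) P0 P"
    and "P0 \<in> sym_matrices" "t \<ge> 0"
  shows "P t \<in> sym_matrices"
proof -
  let ?f = "trace_lyapunov A C \<alpha>"
  have "linear (transpose :: real^'a^'a \<Rightarrow> _)"
    by (rule linearI) (simp_all add: transpose_def vec_eq_iff)
  then have "bounded_linear (transpose :: real^'a^'a \<Rightarrow> _)"
    by (simp add: linear_conv_bounded_linear)
  from bounded_linear.has_vector_derivative[OF this]
  have "is_solution ?f P0 (\<lambda>s. transpose (P s))"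
    using P \<open>P0 \<in> sym_matrices\<close>
    by (auto simp: is_solution_def sym_matrices_def transpose_trace_lyapunov[symmetric])
  from flow_linear_eq[OF bounded_linear_trace_lyapunov this \<open>t \<ge> 0\<close>]
    flow_linear_eq[OF bounded_linear_trace_lyapunov P \<open>t \<ge> 0\<close>]
  have "transpose (P t) = P t" by simp
  then show ?thesis by (simp add: sym_matrices_def)
qed

theorem lemma1:
  fixes A :: "real^'n^'n" and C :: "real^'n^'m" and \<alpha> :: real
  assumes "\<alpha> > 0"
    and "observable A C"
  shows "strictly_positive_system
    (\<lambda>P. transpose A ** P + P ** A + (\<alpha> * trace P) *\<^sub>R (transpose C ** C))"
proof -
  let ?f = "trace_lyapunov A C \<alpha>"
  note lin = bounded_linear_trace_lyapunov[of A C \<alpha>]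
  have ex: "\<exists>P. is_solution ?f P0 P \<and> (\<forall>t. (P has_vector_derivative ?f (P t)) (at t))" for P0
  proof -
    obtain P where "P 0 = P0" "\<And>t. (P has_vector_derivative ?f (P t)) (at t)"
      using linear_ode_solution_exists[OF lin, of 0 P0] by blast
    then show ?thesis
      by (auto simp: is_solution_def intro: has_vector_derivative_at_within)
  qed
  have pos: "flow ?f t P0 \<in> int_psd_cone" if "P0 \<in> psd_cone" "P0 \<noteq> 0" "t > 0" for P0 t
  proof -
    obtain P where P: "is_solution ?f P0 P" "\<And>t. (P has_vector_derivative ?f (P t)) (at t)"
      using ex[of P0] by blast
    have "P 0 = P0" using P(1) by (simp add: is_solution_def)
    moreover have "P s \<in> sym_matrices" if "s \<ge> 0" for s
      using is_solution_trace_lyapunov_sym[OF P(1) _ that] \<open>P0 \<in> psd_cone\<close>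
      by (simp add: psd_cone_def)
    ultimately have "P t \<in> int_psd_cone"
      using that assms by (auto intro!: solution_posdef[OF P(2)])
    then show ?thesis
      using flow_linear_eq[OF lin P(1)] \<open>t > 0\<close> by simp
  qed
  \<comment> \<open>By linearity strict order preservation reduces to \<open>pos\<close> for the
    nonzero semidefinite matrix \<open>Y - X\<close>.\<close>
  have diff: "flow ?f t Y - flow ?f t X = flow ?f t (Y - X)" if "t > 0" for X Y t
  proof -
    obtain x y where x: "is_solution ?f X x" and y: "is_solution ?f Y y"
      using ex[of X] ex[of Y] by blast
    from flow_linear_eq[OF lin is_solution_linear_diff[OF lin x y]]
      flow_linear_eq[OF lin x] flow_linear_eq[OF lin y]
    show ?thesis using that by simp
  qed
  have "flow ?f t P0 \<in> psd_cone" if "P0 \<in> psd_cone" "t > 0" for P0 t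
  proof (cases "P0 = 0")
    case True
    \<comment> \<open>With both arguments 0, \<open>diff\<close> reads
      \<open>0 = flow ?f t 0\<close>.\<close>
    have "flow ?f t 0 = 0" using diff[OF \<open>t > 0\<close>, of 0 0] by simp
    then show ?thesis using that True by simp
  next
    case False
    then have "flow ?f t P0 \<in> int_psd_cone" by (intro pos that)
    then show ?thesis
      unfolding int_psd_cone_def by (rule subsetD[OF interior_of_subset])
  qed
  moreover have "flow ?f t Y - flow ?f t X \<in> int_psd_cone"
    if "X \<preceq> Y" "X \<noteq> Y" "t > 0" for X Y t
    unfolding diff[OF \<open>t > 0\<close>] using that by (intro pos) (simp_all add: loewner_le_def)
  ultimately have "strictly_positive_system ?f"
    unfolding strictly_positive_system_def strictly_order_preserving_def by blast
  then show ?thesis by (simp add: trace_lyapunov_def[abs_def])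
qed

end
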